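(* Let $n$ be a positive integer, let $\mathcal B\subseteq\mathcal P([n])$ be a simply rooted family with $|\mathcal B|=m$, and let $p\in[0,1]$. Suppose that $|\mathcal B_{\{i\}}|\le pm$ for all $i\in[n]$. Then \[ \|\mathcal B\|\le \|\mathcal I(m)\|+m-\frac{m^2(1/12-p^2/12)}{2^n}. \]
   Context: A family $\mathcal B\subseteq\mathcal P([n])$ is simply rooted if for every nonempty $B\in\mathcal B$ there is $b\in B$ with $[\{b\},B]:=\{C:\{b\}\subseteq C\subseteq B\}\subseteq\mathcal B$. For $B\in\mathcal B$ and $i\in[n]$, $B$ is $\mathcal B$-rooted at $i$ if $i\in B$ and $[\{i\},B]\subseteq\mathcal B$. For $S\subseteq[n]$, $\mathcal B_S$ is the family of sets of $\mathcal B$ that are $\mathcal B$-rooted at some $i\in S$. For a finite family $\mathcal F$ of finite sets, $\|\mathcal F\|=\sum_{F\in\mathcal F}|F|$. The colex order on finite sets of positive integers: $A<B$ iff $\max(A\triangle B)\in B$; $\mathcal I(m)$ is the family of the first $m$ sets in this order. *)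

theory Defs
  imports Complex_Main
begin

(* For a set B the interval {{i}..B} is {C. {i} \<subseteq> C \<and> C \<subseteq> B}; it is empty unless i \<in> B,
   so the membership condition i \<in> B is stated separately. *)
definition rooted_at :: "'a set set \<Rightarrow> 'a set \<Rightarrow> 'a \<Rightarrow> bool" where
  "rooted_at \<B> B i \<longleftrightarrow> i \<in> B \<and> {{i}..B} \<subseteq> \<B>"

definition simply_rooted :: "'a set set \<Rightarrow> bool" where
  "simply_rooted \<B> \<longleftrightarrow> (\<forall>B\<in>\<B>. B \<noteq> {} \<longrightarrow> (\<exists>b\<in>B. {{b}..B} \<subseteq> \<B>))"

definition rooted_subfamily :: "'a set set \<Rightarrow> 'a set \<Rightarrow> 'a set set" where
  "rooted_subfamily \<B> S = {B \<in> \<B>. \<exists>i\<in>S. rooted_at \<B> B i}"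

definition total_size :: "'a set set \<Rightarrow> nat" where
  "total_size \<F> = (\<Sum>F\<in>\<F>. card F)"

(* The inequality A \<noteq> B guarantees that Max is taken over a nonempty set. *)
definition colex_less :: "nat set \<Rightarrow> nat set \<Rightarrow> bool" where
  "colex_less A B \<longleftrightarrow> A \<noteq> B \<and> Max ((A - B) \<union> (B - A)) \<in> B"

definition finite_pos_sets :: "nat set set" where
  "finite_pos_sets = {A. finite A \<and> 0 \<notin> A}"

(* A set is among the first m sets iff fewer than m sets precede it. Every finite set of
   positive integers has only finitely many predecessors, all of them subsets of {1..Max A},
   so card is the true number of predecessors. *)
definition colex_initial :: "nat \<Rightarrow> nat set set" where
  "colex_initial m =
     {A \<in> finite_pos_sets. card {C \<in> finite_pos_sets. colex_less C A} < m}"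

end

(* For a family H let e(H) be the number of edges of the cube inside H, ||H|| the total size of H,
   and h(m) = ||I(m)||. Put F = B_S and let G consist of the sets of B rooted outside S, together
   with the empty set if it lies in B. Every set of a rooted family has at most one down-neighbour
   missing, and sets with two roots have none missing. With z = |F \<inter> G| this gives
     ||B|| <= e(B) + m - z   and   ||B|| <= e(F) + e(G) - ||F \<inter> G|| + m + z.
   Here e(B) <= h(m), and the key inequality, valid for arbitrary F and G, is
     e(F) + e(G) - ||F \<inter> G|| <= h(|F \<union> G|) - |F||G| / 2^n + z.
   Combining the two bounds, ||B|| is at most h(m) + m - |F||G| / (3 * 2^n); choosing S as an initial
   segment of [n] for which |B_S| is within pm/2 of m/2 gives the theorem.

   The key inequality does not survive induction on n. With x, y, z, e the numbers of sets in
   F - G, G - F, F \<inter> G and in neither, the error |F||G| / 2^n - z equals (xy - ze) / 2^n, which is at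
   most 2 (xy - sqrt(xyze)) / 2^n by AM-GM. The latter, truncated at 0, can be carried through the
   induction, using only h(a + b) >= h(a) + h(b) + min a b. *)
theory Submission
  imports Defs "HOL-Library.Nat_Bijection"
begin

subsection \<open>Colex initial segments\<close>

text \<open>The total number of binary ones in 0, ..., m - 1. This is the h(m) of the overview,
  since the k-th set in colex order is \<open>set_decode k\<close> shifted by one.\<close>

definition bitsum :: "nat \<Rightarrow> nat" where
  "bitsum m = (\<Sum>k<m. card (set_decode k))"

lemma card_set_decode_double: "card (set_decode (2 * k)) = card (set_decode k)"
proof -
  have "set_decode (2 * k) = Suc ` set_decode k"
  proof (rule set_eqI)
    show "i \<in> set_decode (2 * k) \<longleftrightarrow> i \<in> Suc ` set_decode k" for i
      by (cases i) auto
  qed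
  then show ?thesis by (simp add: card_image)
qed

lemma card_set_decode_Suc_double: "card (set_decode (Suc (2 * k))) = Suc (card (set_decode k))"
proof -
  have "set_decode (Suc (2 * k)) = insert 0 (Suc ` set_decode k)"
  proof (rule set_eqI)
    show "i \<in> set_decode (Suc (2 * k)) \<longleftrightarrow> i \<in> insert 0 (Suc ` set_decode k)" for i
      by (cases i) auto
  qed
  then show ?thesis by (simp add: card_image)
qed

lemma bitsum_0 [simp]: "bitsum 0 = 0"
  by (simp add: bitsum_def)

lemma bitsum_Suc: "bitsum (Suc k) = bitsum k + card (set_decode k)"
  by (simp add: bitsum_def)

lemma bitsum_double: "bitsum (2 * k) = 2 * bitsum k + k"
  by (induction k) (simp_all add: bitsum_Suc card_set_decode_double card_set_decode_Suc_double)

lemma bitsum_Suc_double: "bitsum (Suc (2 * k)) = bitsum k + bitsum (Suc k) + k"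
  by (simp add: bitsum_Suc bitsum_double card_set_decode_double)

text \<open>Splitting the numbers below a, b and a + b by parity leaves sums over about half as many
  numbers. The induction hypothesis is applied to the halves of a and b, and the minima add
  up.\<close>

lemma bitsum_superadditive: "bitsum a + bitsum b + min a b \<le> bitsum (a + b)"
proof (induction "a + b" arbitrary: a b rule: less_induct)
  case less
  show ?case
  proof (cases "a = 0 \<or> b = 0")
    case True
    then show ?thesis by auto
  next
    case False
    have parity: "\<exists>i. c = 2 * i \<or> c = Suc (2 * i)" for c :: nat
      by presburger
    obtain i where i: "a = 2 * i \<or> a = Suc (2 * i)" using parity by blast
    obtain j where j: "b = 2 * j \<or> b = Suc (2 * j)" using parity by blast
    consider (ee) "a = 2 * i" "b = 2 * j" | (eo) "a = 2 * i" "b = Suc (2 * j)"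
      | (oe) "a = Suc (2 * i)" "b = 2 * j" | (oo) "a = Suc (2 * i)" "b = Suc (2 * j)"
      using i j by blast
    then show ?thesis
    proof cases
      case ee
      have "bitsum (a + b) = 2 * bitsum (i + j) + (i + j)"
        using bitsum_double[of "i + j"] ee by (simp add: algebra_simps)
      moreover have "bitsum i + bitsum j + min i j \<le> bitsum (i + j)"
        using ee False by (intro less) auto
      moreover have "bitsum a = 2 * bitsum i + i" "bitsum b = 2 * bitsum j + j"
        using ee by (simp_all add: bitsum_double)
      ultimately show ?thesis using ee by linarith
    next
      case eo
      have "bitsum (a + b) = bitsum (i + j) + bitsum (i + Suc j) + (i + j)"
        using bitsum_Suc_double[of "i + j"] eo by (simp add: algebra_simps)
      moreover have "bitsum i + bitsum j + min i j \<le> bitsum (i + j)"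
        using eo False by (intro less) auto
      moreover have "bitsum i + bitsum (Suc j) + min i (Suc j) \<le> bitsum (i + Suc j)"
        using eo False by (intro less) auto
      moreover have "bitsum a = 2 * bitsum i + i" "bitsum b = bitsum j + bitsum (Suc j) + j"
        using eo by (simp_all add: bitsum_double bitsum_Suc_double)
      ultimately show ?thesis using eo by linarith
    next
      case oe
      have "bitsum (a + b) = bitsum (i + j) + bitsum (Suc i + j) + (i + j)"
        using bitsum_Suc_double[of "i + j"] oe by (simp add: algebra_simps)
      moreover have "bitsum i + bitsum j + min i j \<le> bitsum (i + j)"
        using oe False by (intro less) auto
      moreover have "bitsum (Suc i) + bitsum j + min (Suc i) j \<le> bitsum (Suc i + j)"
        using oe False by (intro less) auto
      moreover have "bitsum a = bitsum i + bitsum (Suc i) + i" "bitsum b = 2 * bitsum j + j"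
        using oe by (simp_all add: bitsum_double bitsum_Suc_double)
      ultimately show ?thesis using oe by linarith
    next
      case oo
      \<comment> \<open>With both numbers odd the halves are paired crosswise, smaller with larger,
        so that both pairs have the required sum \<open>Suc (i + j)\<close>.\<close>
      have "bitsum (a + b) = bitsum (i + Suc j) + bitsum (Suc i + j) + Suc (i + j)"
        using bitsum_double[of "Suc (i + j)"] oo by (simp add: algebra_simps)
      moreover have "bitsum i + bitsum (Suc j) + min i (Suc j) \<le> bitsum (i + Suc j)"
        using oo by (intro less) auto
      moreover have "bitsum (Suc i) + bitsum j + min (Suc i) j \<le> bitsum (Suc i + j)"
        using oo by (intro less) auto
      moreover have "bitsum a = bitsum i + bitsum (Suc i) + i" "bitsum b = bitsum j + bitsum (Suc j) + j"
        using oo by (simp_all add: bitsum_Suc_double)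
      ultimately show ?thesis using oo by linarith
    qed
  qed
qed

section \<open>Colex order as the order of binary codes\<close>

text \<open>The largest element M of the symmetric difference decides: above M the codes agree, and
  everything that A has below M weighs less than the single term \<open>2 ^ M\<close> of B.\<close>

lemma set_encode_less:
  assumes "finite A" "finite B" "A \<noteq> B" "Max ((A - B) \<union> (B - A)) \<in> B"
  shows "set_encode A < set_encode B"
proof -
  define M where "M = Max ((A - B) \<union> (B - A))"
  have fin: "finite ((A - B) \<union> (B - A))" and ne: "(A - B) \<union> (B - A) \<noteq> {}"
    using assms by auto
  have M: "M \<in> B" "M \<notin> A"
    using Max_in[OF fin ne] assms(4) by (auto simp: M_def)
  have same: "i \<in> A \<longleftrightarrow> i \<in> B" if "i > M" for i
    using Max_ge[OF fin, of i] that by (auto simp: M_def)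
  have "set_encode A = (\<Sum>i\<in>A \<inter> {..M}. 2 ^ i) + (\<Sum>i\<in>A \<inter> {M<..}. 2 ^ i)"
    using assms(1) unfolding set_encode_def
    by (subst sum.union_disjoint[symmetric]) (auto intro!: sum.cong)
  also have "(\<Sum>i\<in>A \<inter> {..M}. 2 ^ i) \<le> (\<Sum>i<M. (2::nat) ^ i)"
    using M by (intro sum_mono2) (auto simp: order_le_less)
  also have "(\<Sum>i<M. (2::nat) ^ i) < 2 ^ M"
    by (induction M) auto
  also have "2 ^ M \<le> (\<Sum>i\<in>B \<inter> {..M}. (2::nat) ^ i)"
    using M assms(2) by (intro member_le_sum) auto
  also have "A \<inter> {M<..} = B \<inter> {M<..}"
    using same by auto
  also have "(\<Sum>i\<in>B \<inter> {..M}. (2::nat) ^ i) + (\<Sum>i\<in>B \<inter> {M<..}. 2 ^ i) = set_encode B"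
    using assms(2) unfolding set_encode_def
    by (subst sum.union_disjoint[symmetric]) (auto intro!: sum.cong)
  finally show ?thesis by simp
qed

text \<open>The shift by \<open>Suc\<close> turns bit positions, which start at 0, into positive
  integers; being monotone, it commutes with \<open>Max\<close>. The converse direction follows
  because colex order is total.\<close>

lemma colex_less_Suc_decode:
  "colex_less (Suc ` set_decode j) (Suc ` set_decode k) \<longleftrightarrow> j < k"
proof -
  have *: "j < k" if "colex_less (Suc ` set_decode j) (Suc ` set_decode k)" for j k
  proof -
    let ?A = "set_decode j" and ?B = "set_decode k"
    let ?D = "(?A - ?B) \<union> (?B - ?A)"
    have ne: "?A \<noteq> ?B" using that by (auto simp: colex_less_def)
    have "(Suc ` ?A - Suc ` ?B) \<union> (Suc ` ?B - Suc ` ?A) = Suc ` ?D"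
      by auto
    moreover have "Max (Suc ` ?D) = Suc (Max ?D)"
      using ne by (intro mono_Max_commute[symmetric]) (auto simp: mono_def)
    ultimately have "Max ?D \<in> ?B"
      using that by (auto simp: colex_less_def)
    then have "set_encode ?A < set_encode ?B"
      using ne by (intro set_encode_less) auto
    then show ?thesis by simp
  qed
  have "colex_less (Suc ` set_decode j) (Suc ` set_decode k)" if "j < k"
  proof (rule ccontr)
    let ?A = "Suc ` set_decode j" and ?B = "Suc ` set_decode k"
    assume no: "\<not> ?thesis"
    have "set_decode j \<noteq> set_decode k"
      using that by (metis less_irrefl set_decode_inverse)
    then have ne: "?A \<noteq> ?B" by (simp add: inj_image_eq_iff)
    then have "Max ((?A - ?B) \<union> (?B - ?A)) \<in> (?A - ?B) \<union> (?B - ?A)"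
      by (intro Max_in) auto
    then have "colex_less ?B ?A"
      using no ne by (auto simp: colex_less_def Un_commute)
    then show False using *[of k j] that by simp
  qed
  then show ?thesis using * by blast
qed

lemma finite_pos_sets_eq: "finite_pos_sets = range (\<lambda>k. Suc ` set_decode k)"
proof -
  have "A \<in> range (\<lambda>k. Suc ` set_decode k)" if "finite A" "0 \<notin> A" for A
  proof -
    have "Suc (i - 1) = i" if "i \<in> A" for i
      using that \<open>0 \<notin> A\<close> by (cases i) auto
    then have "(\<lambda>i. Suc (i - 1)) ` A = (\<lambda>i. i) ` A"
      by (intro image_cong) auto
    then have "A = Suc ` (\<lambda>i. i - 1) ` A"
      by (simp add: image_image)
    also have "(\<lambda>i. i - 1) ` A = set_decode (set_encode ((\<lambda>i. i - 1) ` A))"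
      using that(1) by simp
    finally show ?thesis by (rule range_eqI)
  qed
  then have "finite_pos_sets \<subseteq> range (\<lambda>k. Suc ` set_decode k)"
    unfolding finite_pos_sets_def by blast
  moreover have "range (\<lambda>k. Suc ` set_decode k) \<subseteq> finite_pos_sets"
    by (auto simp: finite_pos_sets_def)
  ultimately show ?thesis by (rule subset_antisym)
qed

lemma inj_Suc_decode: "inj (\<lambda>k. Suc ` set_decode k)"
proof (rule injI)
  fix j k assume "Suc ` set_decode j = Suc ` set_decode k"
  then have "set_decode j = set_decode k" by (simp add: inj_image_eq_iff)
  then show "j = k" by (metis set_decode_inverse)
qed

lemma colex_initial_eq: "colex_initial m = (\<lambda>k. Suc ` set_decode k) ` {..<m}"
proof -
  let ?s = "\<lambda>k. Suc ` set_decode k"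
  have "card {C \<in> finite_pos_sets. colex_less C (?s k)} = k" for k
  proof -
    have "{C \<in> finite_pos_sets. colex_less C (?s k)} = ?s ` {..<k}"
      by (auto simp: finite_pos_sets_eq colex_less_Suc_decode)
    then show ?thesis
      using card_image[OF inj_on_subset[OF inj_Suc_decode]] by simp
  qed
  then show ?thesis
    by (auto simp: colex_initial_def finite_pos_sets_eq)
qed

lemma total_size_colex_initial: "total_size (colex_initial m) = bitsum m"
  unfolding total_size_def colex_initial_eq bitsum_def
  by (subst sum.reindex[OF inj_on_subset[OF inj_Suc_decode]]) (auto simp: card_image)

subsection \<open>The loss function\<close>

text \<open>Cauchy-Schwarz for the vectors (sqrt a, sqrt c) and (sqrt b, sqrt d).\<close>

lemma sqrt_mult_add_le:
  assumes "0 \<le> a" "0 \<le> b" "0 \<le> c" "0 \<le> (d::real)"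
  shows "sqrt (a * b) + sqrt (c * d) \<le> sqrt ((a + c) * (b + d))"
proof (rule real_le_rsqrt)
  have "2 * (sqrt (a * d) * sqrt (b * c)) \<le> a * d + b * c"
    using sum_squares_bound[of "sqrt (a * d)" "sqrt (b * c)"] assms by simp
  moreover have "sqrt (a * d) * sqrt (b * c) = sqrt (a * b) * sqrt (c * d)"
    by (simp add: real_sqrt_mult)
  ultimately show "(sqrt (a * b) + sqrt (c * d))\<^sup>2 \<le> (a + c) * (b + d)"
    using assms by (simp add: power2_sum algebra_simps)
qed

lemma sqrt_mult4: "sqrt (a * b * c * d) = sqrt (a * b) * sqrt (c * (d::real))"
  by (simp add: real_sqrt_mult)

lemma sqrt_prod_superadditive:
  assumes "0 \<le> x0" "0 \<le> y0" "0 \<le> z0" "0 \<le> e0" "0 \<le> x1" "0 \<le> y1" "0 \<le> z1" "0 \<le> (e1::real)"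
  shows "(sqrt (x0 * y0) + sqrt (x1 * y1)) * (sqrt (z0 * e0) + sqrt (z1 * e1))
    \<le> sqrt ((x0 + x1) * (y0 + y1) * (z0 + z1) * (e0 + e1))"
  unfolding sqrt_mult4 using assms by (intro mult_mono sqrt_mult_add_le add_nonneg_nonneg) auto

text \<open>Chebyshev's sum inequality: if \<open>x * y\<close> and \<open>z * e\<close> are
  oppositely ordered, so are their square roots, and the product of the sums is at least twice the
  sum of the products.\<close>

lemma sqrt_prod_opposite:
  assumes "0 \<le> x0" "0 \<le> y0" "0 \<le> z0" "0 \<le> e0" "0 \<le> x1" "0 \<le> y1" "0 \<le> z1" "0 \<le> (e1::real)"
    and "(x0 * y0 - x1 * y1) * (z0 * e0 - z1 * e1) \<le> 0"
  shows "2 * sqrt (x0 * y0 * z0 * e0) + 2 * sqrt (x1 * y1 * z1 * e1)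
    \<le> sqrt ((x0 + x1) * (y0 + y1) * (z0 + z1) * (e0 + e1))"
proof -
  have "(sqrt (x0 * y0) - sqrt (x1 * y1)) * (sqrt (z0 * e0) - sqrt (z1 * e1)) \<le> 0"
    using assms(9) by (auto simp: mult_le_0_iff)
  with sqrt_prod_superadditive[OF assms(1-8)] show ?thesis
    unfolding sqrt_mult4 by (simp add: algebra_simps)
qed

text \<open>Each product of sums, such as \<open>(x0 + x1) * (z0 + z1)\<close>, is twice the sum of
  products plus a surplus, nonnegative by \<open>opp\<close>. One use of Cauchy-Schwarz joins the
  two products, a second one adds the surpluses.\<close>

lemma sqrt_prod_split:
  assumes nn: "0 \<le> x0" "0 \<le> y0" "0 \<le> z0" "0 \<le> e0" "0 \<le> x1" "0 \<le> y1" "0 \<le> z1" "0 \<le> (e1::real)"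
    and opp: "(x1 - x0) * (z1 - z0) \<le> 0" "(y1 - y0) * (e1 - e0) \<le> 0"
  shows "2 * sqrt (x0 * z0 * y0 * e0) + 2 * sqrt (x1 * z1 * y1 * e1)
      + sqrt (((x1 - x0) * (z0 - z1)) * ((y0 - y1) * (e1 - e0)))
    \<le> sqrt ((x0 + x1) * (z0 + z1) * (y0 + y1) * (e0 + e1))"
proof -
  let ?p = "2 * (x0 * z0 + x1 * z1)" and ?q = "2 * (y0 * e0 + y1 * e1)"
  have "sqrt ((x0 * z0) * (y0 * e0)) + sqrt ((x1 * z1) * (y1 * e1))
      \<le> sqrt ((x0 * z0 + x1 * z1) * (y0 * e0 + y1 * e1))"
    using nn by (intro sqrt_mult_add_le) auto
  moreover have "sqrt (?p * ?q) = 2 * sqrt ((x0 * z0 + x1 * z1) * (y0 * e0 + y1 * e1))"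
    using real_sqrt_mult[of 4 "(x0 * z0 + x1 * z1) * (y0 * e0 + y1 * e1)"]
    by (simp add: algebra_simps)
  ultimately have "2 * sqrt (x0 * z0 * y0 * e0) + 2 * sqrt (x1 * z1 * y1 * e1) \<le> sqrt (?p * ?q)"
    by (simp add: mult.assoc)
  moreover have "sqrt (?p * ?q) + sqrt (((x1 - x0) * (z0 - z1)) * ((y0 - y1) * (e1 - e0)))
      \<le> sqrt ((?p + (x1 - x0) * (z0 - z1)) * (?q + (y0 - y1) * (e1 - e0)))"
    using nn opp by (intro sqrt_mult_add_le) (auto simp: algebra_simps)
  moreover have "?p + (x1 - x0) * (z0 - z1) = (x0 + x1) * (z0 + z1)"
    "?q + (y0 - y1) * (e1 - e0) = (y0 + y1) * (e0 + e1)"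
    by (auto simp: algebra_simps)
  ultimately show ?thesis by (simp add: mult.assoc)
qed

section \<open>The loss under joining two half-cubes\<close>

text \<open>The factor \<open>2 / 2 ^ card V\<close> is supplied only in
  \<open>edges_pair_le\<close>. Since joining two half-cubes doubles the denominator, the losses of
  the halves appear below with a factor 2.\<close>

definition loss :: "real \<Rightarrow> real \<Rightarrow> real \<Rightarrow> real \<Rightarrow> real" where
  "loss x y z e = max 0 (x * y - sqrt (x * y * z * e))"

lemma loss_swap: "loss x y z e = loss y x z e"
  by (simp add: loss_def mult.commute)

lemma loss_nonneg: "0 \<le> loss x y z e"
  by (simp add: loss_def)

lemma loss_ge: "x * y - sqrt (x * y * z * e) \<le> loss x y z e"
  by (simp add: loss_def)

lemma loss_truncated:
  assumes "0 \<le> x" "0 \<le> y"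
  shows "loss x y z e = x * y - sqrt (x * y) * min (sqrt (x * y)) (sqrt (z * e))"
proof -
  have sq: "sqrt (x * y) * sqrt (x * y) = x * y"
    using assms by simp
  show ?thesis
  proof (cases "sqrt (x * y) \<le> sqrt (z * e)")
    case True
    then have "sqrt (x * y) * sqrt (x * y) \<le> sqrt (x * y) * sqrt (z * e)"
      using assms by (intro mult_left_mono) auto
    then show ?thesis
      using True sq by (simp add: loss_def sqrt_mult4)
  next
    case False
    then have "sqrt (x * y) * sqrt (z * e) \<le> sqrt (x * y) * sqrt (x * y)"
      using assms by (intro mult_left_mono) auto
    then show ?thesis
      using False sq by (simp add: loss_def sqrt_mult4)
  qed
qed

text \<open>By \<open>sqrt_prod_opposite\<close> the square roots cause no error here; what remains
  comes from expanding \<open>(x0 + x1) * (y0 + y1)\<close>.\<close>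

lemma loss_sum_le_of_opposite:
  assumes nn: "0 \<le> x0" "0 \<le> y0" "0 \<le> z0" "0 \<le> e0" "0 \<le> x1" "0 \<le> y1" "0 \<le> z1" "0 \<le> (e1::real)"
    and opp: "(x0 * y0 - x1 * y1) * (z0 * e0 - z1 * e1) \<le> 0"
  shows "(x0 + x1) * (y0 + y1) - sqrt ((x0 + x1) * (y0 + y1) * (z0 + z1) * (e0 + e1))
    \<le> 2 * loss x0 y0 z0 e0 + 2 * loss x1 y1 z1 e1 - (x1 - x0) * (y1 - y0)"
proof -
  have "(x0 + x1) * (y0 + y1) = 2 * (x0 * y0) + 2 * (x1 * y1) - (x1 - x0) * (y1 - y0)"
    by (simp add: algebra_simps)
  then show ?thesis
    using sqrt_prod_opposite[OF nn opp] loss_ge[of x0 y0 z0 e0] loss_ge[of x1 y1 z1 e1] by linarith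
qed

text \<open>If \<open>x * y\<close> and \<open>z * e\<close> both decrease, then \<open>sqrt (z * e)\<close> has to be truncated as in
  \<open>loss_truncated\<close>: only then is the error linear in the decrease of \<open>y\<close>.\<close>

lemma loss_sum_le_of_decreasing:
  assumes nn: "0 \<le> x0" "0 \<le> y0" "0 \<le> z0" "0 \<le> e0" "0 \<le> x1" "0 \<le> y1" "0 \<le> z1" "0 \<le> (e1::real)"
    and le: "x0 \<le> x1" "y1 \<le> y0" and ze: "z1 * e1 \<le> z0 * e0"
  shows "(x0 + x1) * (y0 + y1) - sqrt ((x0 + x1) * (y0 + y1) * (z0 + z1) * (e0 + e1))
    \<le> 2 * loss x0 y0 z0 e0 + 2 * loss x1 y1 z1 e1 + x1 * (y0 - y1)"
proof (cases "x0 * y0 \<le> x1 * y1")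
  case True
  have "(x0 * y0 - x1 * y1) * (z0 * e0 - z1 * e1) \<le> 0"
    using True ze by (intro mult_nonpos_nonneg) auto
  moreover have "0 \<le> x0 * (y0 - y1)"
    using nn le by simp
  ultimately show ?thesis
    using loss_sum_le_of_opposite[OF nn] by (simp add: algebra_simps)
next
  case False
  define p0 p1 where "p0 = sqrt (x0 * y0)" and "p1 = sqrt (x1 * y1)"
  define q0 q1 where "q0 = sqrt (z0 * e0)" and "q1 = sqrt (z1 * e1)"
  define r0 r1 where "r0 = min p0 q0" and "r1 = min p1 q1"
  note defs = p0_def p1_def q0_def q1_def r0_def r1_def
  have nonneg: "0 \<le> p0" "0 \<le> p1" "0 \<le> q0" "0 \<le> q1" "0 \<le> r0" "0 \<le> r1"
    using nn by (auto simp: defs)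
  have "p1 \<le> p0" using False by (simp add: defs)
  have sq: "p0 * p0 = x0 * y0" "p1 * p1 = x1 * y1"
    using nn by (simp_all add: defs)
  have "(p0 + p1) * (r0 + r1) \<le> (p0 + p1) * (q0 + q1)"
    using nonneg by (intro mult_left_mono) (auto simp: r0_def r1_def)
  also have "\<dots> \<le> sqrt ((x0 + x1) * (y0 + y1) * (z0 + z1) * (e0 + e1))"
    unfolding defs using nn by (rule sqrt_prod_superadditive)
  finally have 1: "(p0 + p1) * (r0 + r1) \<le> sqrt ((x0 + x1) * (y0 + y1) * (z0 + z1) * (e0 + e1))" .
  \<comment> \<open>This product is the deficit of \<open>(p0 + p1) * (r0 + r1)\<close> against
    \<open>2 * (p0 * r0 + p1 * r1)\<close>. The cap \<open>r0 \<le> p0\<close> bounds it by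
    \<open>p0 * p0 - p0 * p1\<close>, hence by \<open>x0 * (y0 - y1)\<close>.\<close>
  have "(p0 - p1) * (r0 - r1) \<le> (p0 - p1) * p0"
  proof (rule mult_left_mono)
    have "r0 \<le> p0" by (simp add: r0_def)
    then show "r0 - r1 \<le> p0" using nonneg by simp
  qed (use \<open>p1 \<le> p0\<close> in simp)
  moreover have "x0 * y1 \<le> p0 * p1"
  proof -
    have "x0 * y1 \<le> x0 * y0" "x0 * y1 \<le> x1 * y1"
      using nn le by (simp_all add: mult_left_mono mult_right_mono)
    moreover have "0 \<le> x0 * y0" "0 \<le> x0 * y1" using nn by simp_all
    ultimately have "(x0 * y1) * (x0 * y1) \<le> (x0 * y0) * (x1 * y1)"
      by (rule mult_mono)
    then have "sqrt ((x0 * y1) * (x0 * y1)) \<le> sqrt ((x0 * y0) * (x1 * y1))"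
      by (rule real_sqrt_le_mono)
    moreover have "sqrt ((x0 * y0) * (x1 * y1)) = p0 * p1"
      by (simp only: defs real_sqrt_mult)
    ultimately show ?thesis using nn by simp
  qed
  ultimately have 2: "(p0 - p1) * (r0 - r1) \<le> x0 * y0 - x0 * y1"
    using sq by (simp add: algebra_simps)
  have "loss x0 y0 z0 e0 = x0 * y0 - p0 * r0" "loss x1 y1 z1 e1 = x1 * y1 - p1 * r1"
    using nn by (simp_all add: loss_truncated defs)
  with 1 2 show ?thesis by (simp add: algebra_simps)
qed

text \<open>The previous case under two simultaneous exchanges: of the halves 0 and 1, and of x and
  y.\<close>

lemma loss_sum_le_of_increasing:
  assumes nn: "0 \<le> x0" "0 \<le> y0" "0 \<le> z0" "0 \<le> e0" "0 \<le> x1" "0 \<le> y1" "0 \<le> z1" "0 \<le> (e1::real)"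
    and le: "x0 \<le> x1" "y1 \<le> y0" and ze: "z0 * e0 \<le> z1 * e1"
  shows "(x0 + x1) * (y0 + y1) - sqrt ((x0 + x1) * (y0 + y1) * (z0 + z1) * (e0 + e1))
    \<le> 2 * loss x0 y0 z0 e0 + 2 * loss x1 y1 z1 e1 + y0 * (x1 - x0)"
  using loss_sum_le_of_decreasing[of y1 x1 z1 e1 y0 x0 z0 e0] assms
  by (simp add: loss_swap[of x0] loss_swap[of x1] add.commute mult.commute mult.left_commute)

text \<open>Grouping the four factors as x with z and y with e gains the last square root.\<close>

lemma loss_sum_le_of_split:
  assumes nn: "0 \<le> x0" "0 \<le> y0" "0 \<le> z0" "0 \<le> e0" "0 \<le> x1" "0 \<le> y1" "0 \<le> z1" "0 \<le> (e1::real)"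
    and opp: "(x1 - x0) * (z1 - z0) \<le> 0" "(y1 - y0) * (e1 - e0) \<le> 0"
  shows "(x0 + x1) * (y0 + y1) - sqrt ((x0 + x1) * (y0 + y1) * (z0 + z1) * (e0 + e1))
    \<le> 2 * loss x0 y0 z0 e0 + 2 * loss x1 y1 z1 e1 - (x1 - x0) * (y1 - y0)
       - sqrt (((x1 - x0) * (z0 - z1)) * ((y0 - y1) * (e1 - e0)))"
proof -
  have "(x0 + x1) * (y0 + y1) = 2 * (x0 * y0) + 2 * (x1 * y1) - (x1 - x0) * (y1 - y0)"
    by (simp add: algebra_simps)
  moreover have swap: "a * c * b * d = a * b * c * d" for a b c d :: real
    by (simp add: mult.assoc mult.left_commute)
  ultimately show ?thesis
    using loss_ge[of x0 y0 z0 e0] loss_ge[of x1 y1 z1 e1]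
      sqrt_prod_split[OF nn opp, unfolded swap[of x0 z0] swap[of x1 z1] swap[of "x0 + x1" "z0 + z1"]]
    by linarith
qed

text \<open>The signs of \<open>z1 - z0\<close> and \<open>e1 - e0\<close> select one of four
  estimates. In the application \<open>K\<close> is the size of a half-cube, \<open>x + z\<close>
  the size of the first family in it and y the size of the rest of the second.\<close>

lemma loss_sum_le_of_mixed:
  assumes nn: "0 \<le> x0" "0 \<le> y0" "0 \<le> z0" "0 \<le> e0" "0 \<le> x1" "0 \<le> y1" "0 \<le> z1" "0 \<le> (e1::real)"
    and le: "x0 \<le> x1" "y1 \<le> y0"
    and total: "x0 + y0 + z0 + e0 = K" "x1 + y1 + z1 + e1 = K"
    and k: "y0 - y1 \<le> k \<or> (x1 + z1) - (x0 + z0) \<le> k" "0 \<le> k"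
  shows "(x0 + x1) * (y0 + y1) - sqrt ((x0 + x1) * (y0 + y1) * (z0 + z1) * (e0 + e1))
    \<le> 2 * loss x0 y0 z0 e0 + 2 * loss x1 y1 z1 e1 + K * k"
    (is "?L \<le> ?R + K * k")
proof -
  have K: "x0 \<le> K" "x1 \<le> K" "y0 \<le> K" "y1 \<le> K" "0 \<le> K" using nn total by auto
  show ?thesis
  proof (cases "z1 \<le> z0")
    case z: True
    show ?thesis
    proof (cases "e1 < e0")
      case True
      \<comment> \<open>The equal totals give
        \<open>y0 - y1 = (x1 + z1) - (x0 + z0) - (e0 - e1)\<close>, so here the second alternative
        implies the first.\<close>
      then have "y0 - y1 \<le> k" using k z total by linarith
      then have "x1 * (y0 - y1) \<le> K * k"
        using K le nn by (intro mult_mono) auto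
      moreover have "z1 * e1 \<le> z0 * e0"
        using True z nn by (intro mult_mono) auto
      ultimately show ?thesis
        using loss_sum_le_of_decreasing[OF nn le] by linarith
    next
      case e: False
      define a b c d where "a = x1 - x0" and "b = y0 - y1" and "c = z0 - z1" and "d = e1 - e0"
      have abcd: "0 \<le> a" "0 \<le> b" "0 \<le> c" "0 \<le> d" "a + d = b + c"
        using le z e total by (auto simp: a_def b_def c_def d_def)
      have "(x1 - x0) * (z1 - z0) \<le> 0" "(y1 - y0) * (e1 - e0) \<le> 0"
        using le z e by (auto intro: mult_nonneg_nonpos mult_nonpos_nonneg)
      from loss_sum_le_of_split[OF nn this]
      have L: "?L \<le> ?R + a * b - sqrt ((a * c) * (b * d))"
        by (simp add: a_def b_def c_def d_def algebra_simps)
      \<comment> \<open>The root is the geometric mean of \<open>a * b\<close> and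
        \<open>c * d\<close>, hence at least the smaller of them. So only a positive
        \<open>a * b - c * d\<close> costs anything, and it factors as
        \<open>(a + d) * (a - c)\<close> because \<open>a + d = b + c\<close>.\<close>
      have "a * b - sqrt ((a * c) * (b * d)) \<le> K * k"
      proof (cases "b \<le> k")
        case True
        then have "a * b \<le> K * k"
          using abcd K nn by (intro mult_mono) (auto simp: a_def)
        moreover have "0 \<le> sqrt ((a * c) * (b * d))" using abcd by simp
        ultimately show ?thesis by linarith
      next
        case False
        then have s: "a - c \<le> k" using k by (auto simp: a_def b_def c_def)
        show ?thesis
        proof (cases "c \<le> a")
          case True
          have "d \<le> b" using True abcd by linarith
          have "(c * d) * (c * d) \<le> (a * b) * (c * d)"
            using abcd True \<open>d \<le> b\<close> by (intro mult_right_mono mult_mono) auto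
          then have "sqrt ((c * d) * (c * d)) \<le> sqrt ((a * c) * (b * d))"
            by (intro real_sqrt_le_mono) (simp add: algebra_simps)
          then have "c * d \<le> sqrt ((a * c) * (b * d))" using abcd by simp
          moreover have "a * b - c * d = (a + d) * (a - c)"
          proof -
            have "b = a + d - c" using abcd by simp
            then show ?thesis by (simp only:) (simp add: algebra_simps)
          qed
          moreover have "(a + d) * (a - c) \<le> K * k"
            using abcd K nn s True total by (intro mult_mono) (auto simp: a_def d_def)
          ultimately show ?thesis by linarith
        next
          case False
          then have "a \<le> c" "b \<le> d" using abcd by auto
          then have "(a * b) * (a * b) \<le> (a * b) * (c * d)"
            using abcd by (intro mult_left_mono mult_mono) auto
          then have "sqrt ((a * b) * (a * b)) \<le> sqrt ((a * c) * (b * d))"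
            by (intro real_sqrt_le_mono) (simp add: algebra_simps)
          then have "a * b \<le> sqrt ((a * c) * (b * d))" using abcd by simp
          moreover have "0 \<le> K * k" using K k by simp
          ultimately show ?thesis by linarith
        qed
      qed
      with L show ?thesis by linarith
    qed
  next
    case z: False
    show ?thesis
    proof (cases "e0 \<le> e1")
      case True
      then have "x1 - x0 \<le> k" using k z total by linarith
      then have "y0 * (x1 - x0) \<le> K * k"
        using K le nn by (intro mult_mono) auto
      moreover have "z0 * e0 \<le> z1 * e1"
        using True z nn by (intro mult_mono) auto
      ultimately show ?thesis
        using loss_sum_le_of_increasing[OF nn le] by linarith
    next
      case e: False
      \<comment> \<open>Here x and z both grow while y and e both shrink, so \<open>x * z\<close>
        and \<open>y * e\<close> are oppositely ordered.\<close>
      have "(x0 * z0 - x1 * z1) * (y0 * e0 - y1 * e1) \<le> 0"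
        using nn le z e by (intro mult_nonpos_nonneg) (auto intro!: mult_mono)
      from sqrt_prod_opposite[OF nn(1,3,2,4,5,7,6,8) this]
      have "2 * sqrt (x0 * y0 * z0 * e0) + 2 * sqrt (x1 * y1 * z1 * e1)
          \<le> sqrt ((x0 + x1) * (y0 + y1) * (z0 + z1) * (e0 + e1))"
        by (simp add: mult.assoc mult.left_commute)
      moreover have "(x0 + x1) * (y0 + y1) = 2 * (x0 * y0) + 2 * (x1 * y1) + (x1 - x0) * (y0 - y1)"
        by (simp add: algebra_simps)
      moreover have "(x1 - x0) * (y0 - y1) \<le> K * k"
      proof (cases "y0 - y1 \<le> k")
        case True
        then show ?thesis using K le nn by (intro mult_mono) auto
      next
        case False
        then have "x1 - x0 \<le> k" using k z by linarith
        then have "(y0 - y1) * (x1 - x0) \<le> K * k"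
          using K le nn by (intro mult_mono) auto
        then show ?thesis by (simp add: mult.commute)
      qed
      ultimately show ?thesis
        using loss_ge[of x0 y0 z0 e0] loss_ge[of x1 y1 z1 e1] by linarith
    qed
  qed
qed

text \<open>If x and y move in opposite directions, this is the mixed case, up to exchanging x and
  y. If they move together, no term \<open>K * k\<close> is needed.\<close>

lemma loss_sum_le:
  assumes nn: "0 \<le> x0" "0 \<le> y0" "0 \<le> z0" "0 \<le> e0" "0 \<le> x1" "0 \<le> y1" "0 \<le> z1" "0 \<le> (e1::real)"
    and total: "x0 + y0 + z0 + e0 = K" "x1 + y1 + z1 + e1 = K"
    and k: "0 \<le> k"
      "y0 - y1 \<le> k \<or> (x1 + z1) - (x0 + z0) \<le> k"
      "x0 - x1 \<le> k \<or> (y1 + z1) - (y0 + z0) \<le> k"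
  shows "loss (x0 + x1) (y0 + y1) (z0 + z1) (e0 + e1)
    \<le> 2 * loss x0 y0 z0 e0 + 2 * loss x1 y1 z1 e1 + K * k" (is "_ \<le> ?R")
proof -
  define x y z e where "x = x0 + x1" and "y = y0 + y1" and "z = z0 + z1" and "e = e0 + e1"
  note defs = x_def y_def z_def e_def
  have "0 \<le> K * k" using nn total k by simp
  then have "0 \<le> ?R" using loss_nonneg[of x0 y0 z0 e0] loss_nonneg[of x1 y1 z1 e1] by simp
  have nonneg: "0 \<le> x" "0 \<le> y" "0 \<le> z" "0 \<le> e" using nn by (simp_all add: defs)
  have "x * y - sqrt (x * y * z * e) \<le> ?R"
  proof (cases "x * y \<le> z * e")
    case True
    then have "(x * y) * (x * y) \<le> (x * y) * (z * e)"
      using nonneg by (intro mult_left_mono) auto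
    then have "sqrt ((x * y) * (x * y)) \<le> sqrt (x * y * z * e)"
      by (intro real_sqrt_le_mono) (simp add: mult.assoc)
    then have "x * y \<le> sqrt (x * y * z * e)" using nonneg by simp
    with \<open>0 \<le> ?R\<close> show ?thesis by linarith
  next
    case ze: False
    consider "x0 \<le> x1" "y1 \<le> y0" | "x1 \<le> x0" "y0 \<le> y1" | "(x1 - x0) * (y1 - y0) \<ge> 0"
      by (metis diff_ge_0_iff_ge linear mult_nonneg_nonneg mult_nonpos_nonpos diff_le_0_iff_le)
    then show ?thesis
    proof cases
      case 1
      then show ?thesis
        using loss_sum_le_of_mixed[OF nn _ _ total k(2,1)] by (simp add: defs)
    next
      case 2
      then show ?thesis
        using loss_sum_le_of_mixed[of y0 x0 z0 e0 y1 x1 z1 e1 K k] nn total k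
        by (simp add: defs loss_swap[of x0] loss_swap[of x1] mult.commute add.commute add.left_commute)
    next
      case 3
      show ?thesis
      proof (cases "(z1 - z0) * (e1 - e0) \<le> 0")
        case True
        let ?D = "(x1 - x0) * (y1 - y0)"
        have "2 * sqrt (x0 * y0 * z0 * e0) + 2 * sqrt (x1 * y1 * z1 * e1)
            = 2 * (sqrt ((x0 * y0) * (z0 * e0)) + sqrt ((x1 * y1) * (z1 * e1)))"
          by (simp add: mult.assoc)
        also have "\<dots> \<le> 2 * sqrt ((x0 * y0 + x1 * y1) * (z0 * e0 + z1 * e1))"
          using sqrt_mult_add_le[of "x0 * y0" "z0 * e0" "x1 * y1" "z1 * e1"] nn by simp
        also have "\<dots> = sqrt ((x * y + ?D) * (z * e + (z1 - z0) * (e1 - e0)))"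
        proof -
          have "(x * y + ?D) * (z * e + (z1 - z0) * (e1 - e0))
              = 4 * ((x0 * y0 + x1 * y1) * (z0 * e0 + z1 * e1))"
            by (simp add: defs algebra_simps)
          then show ?thesis by (simp add: real_sqrt_mult)
        qed
        also have "\<dots> \<le> sqrt ((x * y + ?D) * (z * e))"
          using 3 True nonneg by (intro real_sqrt_le_mono mult_left_mono) auto
        \<comment> \<open>In the present case \<open>z * e < x * y\<close>, so \<open>z * e\<close>
          is at most the geometric mean \<open>sqrt (x * y * z * e)\<close>; this absorbs the cross
          term after squaring.\<close>
        also have "\<dots> \<le> sqrt (x * y * z * e) + ?D"
        proof (rule real_le_lsqrt)
          have "(z * e) * (z * e) \<le> (x * y) * (z * e)"
            using ze nonneg by (intro mult_right_mono) auto
          then have "sqrt ((z * e) * (z * e)) \<le> sqrt (x * y * z * e)"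
            by (intro real_sqrt_le_mono) (simp add: mult.assoc)
          then have "z * e \<le> sqrt (x * y * z * e)" using nonneg by simp
          moreover have "0 \<le> sqrt (x * y * z * e)" using nonneg by simp
          ultimately have "z * e \<le> 2 * sqrt (x * y * z * e) + ?D" using 3 by linarith
          then have "?D * (z * e) \<le> ?D * (2 * sqrt (x * y * z * e) + ?D)"
            using 3 by (intro mult_left_mono) auto
          then show "(x * y + ?D) * (z * e) \<le> (sqrt (x * y * z * e) + ?D)\<^sup>2"
            using nonneg by (simp add: power2_eq_square distrib_left distrib_right mult.assoc mult.commute mult.left_commute)
        qed (use 3 nonneg in auto)
        finally have "2 * sqrt (x0 * y0 * z0 * e0) + 2 * sqrt (x1 * y1 * z1 * e1)
            \<le> sqrt (x * y * z * e) + ?D" .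
        moreover have "x * y = 2 * (x0 * y0) + 2 * (x1 * y1) - ?D"
          by (simp add: defs algebra_simps)
        ultimately show ?thesis
          using loss_ge[of x0 y0 z0 e0] loss_ge[of x1 y1 z1 e1] \<open>0 \<le> K * k\<close> by linarith
      next
        case False
        then consider "z0 < z1" "e0 < e1" | "z1 < z0" "e1 < e0"
          by (auto simp: not_le zero_less_mult_iff)
        \<comment> \<open>If z and e move strictly the same way, the fixed total makes x and y,
          which move together, go the other way.\<close>
        then have "(x0 * y0 - x1 * y1) * (z0 * e0 - z1 * e1) \<le> 0"
        proof cases
          case 1
          then have "x1 \<le> x0 \<and> y1 \<le> y0"
            using 3 total by (auto simp: zero_le_mult_iff)
          then show ?thesis
            using 1 nn by (intro mult_nonneg_nonpos) (auto intro!: mult_mono)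
        next
          case 2
          then have "x0 \<le> x1 \<and> y0 \<le> y1"
            using 3 total by (auto simp: zero_le_mult_iff)
          then show ?thesis
            using 2 nn by (intro mult_nonpos_nonneg) (auto intro!: mult_mono)
        qed
        from loss_sum_le_of_opposite[OF nn this] 3 \<open>0 \<le> K * k\<close> show ?thesis
          by (simp add: defs)
      qed
    qed
  qed
  with \<open>0 \<le> ?R\<close> show ?thesis by (simp add: loss_def[of "x0 + x1"] defs)
qed

subsection \<open>Edges inside two families\<close>

text \<open>Every edge of the cube inside \<open>F\<close> is counted once, at its upper
  end.\<close>

definition edges :: "'a set set \<Rightarrow> nat" where
  "edges F = (\<Sum>A\<in>F. card {i \<in> A. A - {i} \<in> F})"

definition lower :: "'a \<Rightarrow> 'a set set \<Rightarrow> 'a set set" where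
  "lower a F = {A \<in> F. a \<notin> A}"

text \<open>The element \<open>a\<close> is removed so that both halves lie in the same smaller cube
  and can be intersected.\<close>

definition upper :: "'a \<Rightarrow> 'a set set \<Rightarrow> 'a set set" where
  "upper a F = {A. a \<notin> A \<and> insert a A \<in> F}"

lemma lower_set_ops:
  "lower a (F \<inter> G) = lower a F \<inter> lower a G" "lower a (F \<union> G) = lower a F \<union> lower a G"
  "lower a (F - G) = lower a F - lower a G"
  by (auto simp: lower_def)

lemma upper_set_ops:
  "upper a (F \<inter> G) = upper a F \<inter> upper a G" "upper a (F \<union> G) = upper a F \<union> upper a G"
  "upper a (F - G) = upper a F - upper a G"
  by (auto simp: upper_def)

lemma lower_upper_subset:
  assumes "F \<subseteq> Pow (insert a V)"
  shows "lower a F \<subseteq> Pow V" "upper a F \<subseteq> Pow V"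
  using assms by (auto simp: lower_def upper_def)

lemma finite_upper:
  assumes "finite F"
  shows "finite (upper a F)"
proof -
  have "upper a F \<subseteq> (\<lambda>A. A - {a}) ` F"
  proof
    fix A assume A: "A \<in> upper a F"
    then have "A = insert a A - {a}" by (auto simp: upper_def)
    with A show "A \<in> (\<lambda>A. A - {a}) ` F" by (auto simp: upper_def intro: image_eqI)
  qed
  then show ?thesis using assms by (rule finite_surj[rotated])
qed

lemma sum_lower_upper:
  assumes "finite F"
  shows "sum f F = sum f (lower a F) + (\<Sum>A\<in>upper a F. f (insert a A))"
proof -
  have "{A \<in> F. a \<in> A} = insert a ` upper a F"
  proof (intro set_eqI iffI)
    fix A assume A: "A \<in> {A \<in> F. a \<in> A}"
    then have "insert a (A - {a}) = A" by auto
    with A show "A \<in> insert a ` upper a F"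
      by (intro image_eqI[of _ _ "A - {a}"]) (auto simp: upper_def)
  qed (auto simp: upper_def)
  moreover have "inj_on (insert a) (upper a F)"
    by (auto simp: inj_on_def upper_def)
  ultimately have "sum f {A \<in> F. a \<in> A} = (\<Sum>A\<in>upper a F. f (insert a A))"
    by (simp add: sum.reindex)
  moreover have "sum f F = sum f {A \<in> F. a \<notin> A} + sum f {A \<in> F. a \<in> A}"
    using assms by (subst sum.union_disjoint[symmetric]) (auto intro: sum.cong)
  ultimately show ?thesis by (simp add: lower_def)
qed

lemma card_lower_upper: "finite F \<Longrightarrow> card F = card (lower a F) + card (upper a F)"
  using sum_lower_upper[of F "\<lambda>_. 1 :: nat"] by simp

lemma total_size_lower_upper:
  assumes "finite F" "\<And>A. A \<in> F \<Longrightarrow> finite A"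
  shows "total_size F = total_size (lower a F) + total_size (upper a F) + card (upper a F)"
proof -
  have "card (insert a A) = card A + 1" if "A \<in> upper a F" for A
    using that assms(2)[of "insert a A"] by (auto simp: upper_def)
  then show ?thesis
    by (simp add: total_size_def sum_lower_upper[OF assms(1), of card a] sum_Suc)
qed

text \<open>An edge in direction \<open>a\<close> joins the two copies of a set that lies in both
  halves; every other edge stays within one half.\<close>

lemma edges_lower_upper:
  assumes "finite F" "\<And>A. A \<in> F \<Longrightarrow> finite A"
  shows "edges F = edges (lower a F) + edges (upper a F) + card (lower a F \<inter> upper a F)"
proof -
  let ?d = "\<lambda>F A. {i \<in> A. A - {i} \<in> F}"
  have low: "?d F A = ?d (lower a F) A" if "A \<in> lower a F" for A
    using that by (auto simp: lower_def)
  have up: "card (?d F (insert a A)) = card (?d (upper a F) A) + (if A \<in> lower a F then 1 else 0)"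
    if A: "A \<in> upper a F" for A
  proof -
    have "a \<notin> A" "finite A"
      using A assms(2)[of "insert a A"] by (auto simp: upper_def)
    have "insert a A - {i} = insert a (A - {i})" if "i \<in> A" for i
      using that \<open>a \<notin> A\<close> by auto
    then have "?d F (insert a A) = ?d (upper a F) A \<union> (if A \<in> lower a F then {a} else {})"
      using \<open>a \<notin> A\<close> by (auto simp: upper_def lower_def)
    then show ?thesis
      using \<open>a \<notin> A\<close> \<open>finite A\<close> by simp
  qed
  have "(\<Sum>A\<in>lower a F. card (?d F A)) = edges (lower a F)"
    unfolding edges_def using low by (intro sum.cong) auto
  moreover have "(\<Sum>A\<in>upper a F. card (?d F (insert a A)))
      = (\<Sum>A\<in>upper a F. card (?d (upper a F) A) + (if A \<in> lower a F then 1 else 0))"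
    using up by (rule sum.cong[OF refl])
  moreover have "(\<Sum>A\<in>upper a F. if A \<in> lower a F then 1 else 0) = card (lower a F \<inter> upper a F)"
    using finite_upper[OF assms(1)] by (simp add: sum.If_cases Int_commute)
  ultimately show ?thesis
    by (simp only: edges_def[of F] edges_def[of "upper a F"] sum_lower_upper[OF assms(1), of _ a] sum.distrib add.assoc)
qed

text \<open>With \<open>Z\<^sub>i = F\<^sub>i \<inter> G\<^sub>i\<close>, the sets of \<open>Z\<^sub>1 - Z\<^sub>0\<close> are paid for by \<open>card Z\<^sub>1\<close>; the witness \<open>c\<close> is the
  number of the remaining sets with a vertical edge.\<close>

lemma vertical_edges_le:
  fixes F0 F1 G0 G1 :: "'a set"
  assumes fin: "finite F0" "finite F1" "finite G0" "finite G1"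
  obtains c where "card (F0 \<inter> F1) + card (G0 \<inter> G1) \<le> c + card (F1 \<inter> G1)"
    "c \<le> card (F0 \<union> G0)" "c \<le> card (F1 \<union> G1)"
    "c \<le> card F0 + card (G1 - F1)" "c \<le> card G0 + card (F1 - G1)"
proof
  let ?U = "(F0 \<inter> F1) \<union> (G0 \<inter> G1)" and ?D = "F1 \<inter> G1 - F0 \<inter> G0"
  let ?W = "?U - ?D"
  have "card (F0 \<inter> F1) + card (G0 \<inter> G1) = card ?U + card ((F0 \<inter> F1) \<inter> (G0 \<inter> G1))"
    using fin by (intro card_Un_Int) auto
  moreover have "card ?U \<le> card ?W + card ?D"
    using fin card_mono[of "?W \<union> ?D" ?U] card_Un_le[of ?W ?D] by fastforce
  \<comment> \<open>The sets counted twice are those in all four families; together with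
    \<open>?D\<close> they make up \<open>F1 \<inter> G1\<close>.\<close>
  moreover have "card ?D + card ((F0 \<inter> F1) \<inter> (G0 \<inter> G1)) = card (F1 \<inter> G1)"
    using fin by (subst card_Un_disjoint[symmetric]) (auto intro!: arg_cong[where f = card])
  ultimately show "card (F0 \<inter> F1) + card (G0 \<inter> G1) \<le> card ?W + card (F1 \<inter> G1)" by linarith
  show "card ?W \<le> card (F0 \<union> G0)" "card ?W \<le> card (F1 \<union> G1)"
    using fin by (auto intro!: card_mono)
  \<comment> \<open>A set of \<open>?W\<close> outside \<open>F0\<close> lies in
    \<open>G0 \<inter> G1\<close>; it cannot lie in \<open>F1\<close>, for then it would belong to
    \<open>?D\<close>.\<close>
  have "card ?W \<le> card (F0 \<union> (G1 - F1))" "card ?W \<le> card (G0 \<union> (F1 - G1))"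
    using fin by (auto intro!: card_mono)
  then show "card ?W \<le> card F0 + card (G1 - F1)" "card ?W \<le> card G0 + card (F1 - G1)"
    using card_Un_le le_trans by blast+
qed

section \<open>The key inequality for two families\<close>

text \<open>\<open>N\<close> stands for the size of the ambient cube, so the last argument counts
  the sets in neither family.\<close>

definition pair_loss :: "nat \<Rightarrow> 'a set \<Rightarrow> 'a set \<Rightarrow> real" where
  "pair_loss N F G = loss (card (F - G)) (card (G - F)) (card (F \<inter> G)) (real N - card (F \<union> G))"

lemma card_Un_parts:
  assumes "finite F" "finite G"
  shows "card (F \<union> G) = card (F - G) + card (G - F) + card (F \<inter> G)"
    and "card F = card (F - G) + card (F \<inter> G)" and "card G = card (G - F) + card (F \<inter> G)"
proof -
  show "card F = card (F - G) + card (F \<inter> G)" "card G = card (G - F) + card (F \<inter> G)"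
    using assms by (metis card_Int_Diff add.commute Int_commute)+
  with card_Un_Int[OF assms] show "card (F \<union> G) = card (F - G) + card (G - F) + card (F \<inter> G)"
    by simp
qed

text \<open>An instance of \<open>loss_sum_le\<close> with \<open>N\<close> for \<open>K\<close>
  and, for \<open>k\<close>, the smaller of the two unions minus \<open>c\<close>. Which union is
  smaller decides which alternative about \<open>k\<close> holds.\<close>

lemma pair_loss_lower_upper:
  assumes fin: "finite F" "finite G"
    and le: "card (lower a F \<union> lower a G) \<le> N" "card (upper a F \<union> upper a G) \<le> N"
    and c: "c \<le> card (lower a F \<union> lower a G)" "c \<le> card (upper a F \<union> upper a G)"
      "c \<le> card (lower a F) + card (upper a G - upper a F)"
      "c \<le> card (lower a G) + card (upper a F - upper a G)"
  shows "pair_loss (2 * N) F G \<le> 2 * pair_loss N (lower a F) (lower a G)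
    + 2 * pair_loss N (upper a F) (upper a G)
    + real N * (real (min (card (lower a F \<union> lower a G)) (card (upper a F \<union> upper a G))) - real c)"
proof -
  define F0 F1 G0 G1 where "F0 = lower a F" and "F1 = upper a F" and "G0 = lower a G" and "G1 = upper a G"
  note defs = F0_def F1_def G0_def G1_def
  have fin': "finite F0" "finite F1" "finite G0" "finite G1"
    using fin by (auto simp: defs lower_def finite_upper)
  have split: "card (F - G) = card (F0 - G0) + card (F1 - G1)"
    "card (G - F) = card (G0 - F0) + card (G1 - F1)"
    "card (F \<inter> G) = card (F0 \<inter> G0) + card (F1 \<inter> G1)"
    "card (F \<union> G) = card (F0 \<union> G0) + card (F1 \<union> G1)"
    using fin by (simp_all add: card_lower_upper[of _ a] lower_set_ops upper_set_ops defs)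
  note parts = card_Un_parts[OF fin'(1,3)] card_Un_parts[OF fin'(2,4)]
  let ?m0 = "card (F0 \<union> G0)" and ?m1 = "card (F1 \<union> G1)"
  let ?k = "real (min ?m0 ?m1) - real c"
  have "loss (real (card (F0 - G0)) + real (card (F1 - G1))) (real (card (G0 - F0)) + real (card (G1 - F1)))
      (real (card (F0 \<inter> G0)) + real (card (F1 \<inter> G1))) ((real N - ?m0) + (real N - ?m1))
    \<le> 2 * loss (card (F0 - G0)) (card (G0 - F0)) (card (F0 \<inter> G0)) (real N - ?m0)
      + 2 * loss (card (F1 - G1)) (card (G1 - F1)) (card (F1 \<inter> G1)) (real N - ?m1) + real N * ?k"
  proof (rule loss_sum_le)
    show "real (card (G0 - F0)) - real (card (G1 - F1)) \<le> ?k
      \<or> real (card (F1 - G1)) + real (card (F1 \<inter> G1)) - (real (card (F0 - G0)) + real (card (F0 \<inter> G0))) \<le> ?k"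
      using c(3) parts unfolding defs[symmetric] by (cases "?m0 \<le> ?m1") auto
    show "real (card (F0 - G0)) - real (card (F1 - G1)) \<le> ?k
      \<or> real (card (G1 - F1)) + real (card (F1 \<inter> G1)) - (real (card (G0 - F0)) + real (card (F0 \<inter> G0))) \<le> ?k"
      using c(4) parts unfolding defs[symmetric] by (cases "?m0 \<le> ?m1") auto
  qed (use le c parts in \<open>auto simp: defs\<close>)
  then show ?thesis
    by (simp add: pair_loss_def split defs[symmetric] algebra_simps)
qed

text \<open>Induction on the dimension. The vertical edges contribute at most \<open>c\<close>,
  superadditivity of \<open>bitsum\<close> gains the minimum of the two unions, and the loss grows
  by at most the difference of minimum and \<open>c\<close>.\<close>

lemma edges_pair_le:
  assumes "finite V" "F \<subseteq> Pow V" "G \<subseteq> Pow V"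
  shows "real (edges F) + real (edges G) - real (total_size (F \<inter> G))
    \<le> real (bitsum (card (F \<union> G))) - 2 * pair_loss (2 ^ card V) F G / 2 ^ card V"
  using assms
proof (induction V arbitrary: F G rule: finite_induct)
  case empty
  then have "F = {} \<or> F = {{}}" "G = {} \<or> G = {{}}" by auto
  then show ?case
    by (auto simp: edges_def pair_loss_def loss_def total_size_def)
next
  case (insert a V)
  define F0 F1 G0 G1 where "F0 = lower a F" and "F1 = upper a F" and "G0 = lower a G" and "G1 = upper a G"
  note defs = F0_def F1_def G0_def G1_def
  let ?N = "2 ^ card V :: nat"
  have fins: "finite F" "finite G"
    using insert by (auto intro: finite_subset[of _ "Pow (insert a V)"])
  have fin: "finite A" if "A \<in> F \<union> G" for A
    using that insert by (auto intro: finite_subset[of _ "insert a V"])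
  have sub: "F0 \<subseteq> Pow V" "F1 \<subseteq> Pow V" "G0 \<subseteq> Pow V" "G1 \<subseteq> Pow V"
    using lower_upper_subset[OF insert.prems(1)] lower_upper_subset[OF insert.prems(2)]
    by (simp_all add: defs)
  have fin': "finite F0" "finite F1" "finite G0" "finite G1"
    using sub insert.hyps(1) by (auto intro: finite_subset[of _ "Pow V"])
  obtain c where c: "card (F0 \<inter> F1) + card (G0 \<inter> G1) \<le> c + card (F1 \<inter> G1)"
    "c \<le> card (F0 \<union> G0)" "c \<le> card (F1 \<union> G1)"
    "c \<le> card F0 + card (G1 - F1)" "c \<le> card G0 + card (F1 - G1)"
    using vertical_edges_le[OF fin'] .
  have le: "card (F0 \<union> G0) \<le> ?N" "card (F1 \<union> G1) \<le> ?N"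
    using sub insert.hyps(1) by (auto simp: card_Pow[symmetric] intro!: card_mono)
  have "pair_loss (2 * ?N) F G \<le> 2 * pair_loss ?N F0 G0 + 2 * pair_loss ?N F1 G1
      + real ?N * (real (min (card (F0 \<union> G0)) (card (F1 \<union> G1))) - real c)"
    unfolding defs using fins le c by (intro pair_loss_lower_upper) (auto simp: defs)
  then have "pair_loss (2 * ?N) F G / real ?N \<le> (2 * pair_loss ?N F0 G0 + 2 * pair_loss ?N F1 G1
      + real ?N * (real (min (card (F0 \<union> G0)) (card (F1 \<union> G1))) - real c)) / real ?N"
    by (intro divide_right_mono) auto
  also have "\<dots> = 2 * pair_loss ?N F0 G0 / real ?N + 2 * pair_loss ?N F1 G1 / real ?N
      + (real (min (card (F0 \<union> G0)) (card (F1 \<union> G1))) - real c)"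
    by (simp add: add_divide_distrib)
  finally have loss: "pair_loss (2 * ?N) F G / real ?N \<le> \<dots>" .
  have "card (F \<union> G) = card (F0 \<union> G0) + card (F1 \<union> G1)"
    using fins by (simp add: card_lower_upper[of _ a] lower_set_ops upper_set_ops defs)
  then have h: "bitsum (card (F0 \<union> G0)) + bitsum (card (F1 \<union> G1))
      + min (card (F0 \<union> G0)) (card (F1 \<union> G1)) \<le> bitsum (card (F \<union> G))"
    using bitsum_superadditive by simp
  have e: "edges F = edges F0 + edges F1 + card (F0 \<inter> F1)"
    "edges G = edges G0 + edges G1 + card (G0 \<inter> G1)"
    "total_size (F \<inter> G) = total_size (F0 \<inter> G0) + total_size (F1 \<inter> G1) + card (F1 \<inter> G1)"
    using edges_lower_upper[of F a] edges_lower_upper[of G a] total_size_lower_upper[of "F \<inter> G" a] fins fin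
    by (auto simp: defs lower_set_ops upper_set_ops)
  have N: "real ?N = 2 ^ card V" "2 * pair_loss (2 ^ card (insert a V)) F G / 2 ^ card (insert a V)
      = pair_loss (2 * ?N) F G / real ?N"
    using insert.hyps by simp_all
  show ?case
    using insert.IH[OF sub(1,3)] insert.IH[OF sub(2,4)] loss h e c(1) unfolding N by linarith
qed

lemma edges_pair_le_product:
  assumes "finite V" "F \<subseteq> Pow V" "G \<subseteq> Pow V"
  shows "real (edges F) + real (edges G) - real (total_size (F \<inter> G))
    \<le> real (bitsum (card (F \<union> G))) - real (card F) * real (card G) / 2 ^ card V + real (card (F \<inter> G))"
proof -
  define x y z N :: real where "x = card (F - G)" and "y = card (G - F)" and "z = card (F \<inter> G)"
    and "N = 2 ^ card V"
  define e where "e = N - card (F \<union> G)"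
  have fin: "finite F" "finite G"
    using assms by (auto intro: finite_subset[of _ "Pow V"])
  have "card (F \<union> G) \<le> card (Pow V)"
    using assms by (intro card_mono) auto
  then have "real (card (F \<union> G)) \<le> real (2 ^ card V)"
    using assms by (simp only: card_Pow of_nat_le_iff)
  then have nn: "0 \<le> x" "0 \<le> y" "0 \<le> z" "0 \<le> e"
    by (auto simp: x_def y_def z_def e_def N_def)
  have cards: "real (card F) = x + z" "real (card G) = y + z" "N = x + y + z + e"
    using card_Un_parts[OF fin] by (auto simp: x_def y_def z_def e_def)
  \<comment> \<open>AM-GM turns the loss into the bilinear error \<open>x * y - z * e\<close>, which
    equals \<open>(x + z) * (y + z) - z * N\<close>.\<close>
  have "2 * sqrt (x * y * z * e) \<le> x * y + z * e"
    using sum_squares_bound[of "sqrt (x * y)" "sqrt (z * e)"] nn by (simp add: sqrt_mult4)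
  then have "x * y - z * e \<le> 2 * loss x y z e"
    using loss_ge[of x y z e] by simp
  also have "loss x y z e = pair_loss (2 ^ card V) F G"
    by (simp add: pair_loss_def x_def y_def z_def e_def N_def)
  also have "x * y - z * e = real (card F) * real (card G) - z * N"
    unfolding cards by (simp add: algebra_simps)
  finally have "(real (card F) * real (card G) - z * N) / N \<le> 2 * pair_loss (2 ^ card V) F G / N"
    by (intro divide_right_mono) (auto simp: N_def)
  then have "real (card F) * real (card G) / N - z \<le> 2 * pair_loss (2 ^ card V) F G / N"
    by (simp add: diff_divide_distrib N_def)
  then show ?thesis
    using edges_pair_le[OF assms] by (simp add: N_def z_def)
qed

text \<open>The edge-isoperimetric inequality of the cube, as the case of an empty second
  family.\<close>

lemma edges_le:
  fixes F :: "'a set set"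
  assumes "finite V" "F \<subseteq> Pow V"
  shows "edges F \<le> bitsum (card F)"
proof -
  have "edges ({} :: 'a set set) = 0" "total_size ({} :: 'a set set) = 0"
    by (simp_all add: edges_def total_size_def)
  then show ?thesis
    using edges_pair_le_product[OF assms, of "{}"] by simp
qed

subsection \<open>Rooted families\<close>

text \<open>Only deleting the root \<open>b\<close> can lead outside \<open>F\<close>, so each set
  has at most one missing down-neighbour, and the sets of \<open>Z\<close> have none.\<close>

lemma total_size_le_edges:
  assumes fin: "finite F" "\<And>A. A \<in> F \<Longrightarrow> finite A"
    and root: "\<And>A. A \<in> F \<Longrightarrow> A \<noteq> {} \<Longrightarrow> \<exists>b\<in>A. \<forall>i\<in>A - {b}. A - {i} \<in> F"
    and Z: "Z \<subseteq> F" "\<And>A i. A \<in> Z \<Longrightarrow> i \<in> A \<Longrightarrow> A - {i} \<in> F"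
  shows "total_size F + card Z \<le> edges F + card F"
proof -
  have "card A + (if A \<in> Z then 1 else 0) \<le> card {i \<in> A. A - {i} \<in> F} + 1" if A: "A \<in> F" for A
  proof (cases "A \<in> Z")
    case True
    then have "{i \<in> A. A - {i} \<in> F} = A" using Z(2) by auto
    then show ?thesis by simp
  next
    case False
    show ?thesis
    proof (cases "A = {}")
      case nonempty: False
      with root[OF A] obtain b where b: "b \<in> A" "\<forall>i\<in>A - {b}. A - {i} \<in> F" by auto
      then have "card (A - {b}) \<le> card {i \<in> A. A - {i} \<in> F}"
        using fin(2)[OF A] by (intro card_mono) auto
      then show ?thesis using False b(1) fin(2)[OF A] by simp
    qed (use False in simp)
  qed
  then have "(\<Sum>A\<in>F. card A + (if A \<in> Z then 1 else 0)) \<le> (\<Sum>A\<in>F. card {i \<in> A. A - {i} \<in> F} + 1)"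
    by (rule sum_mono)
  moreover have "(\<Sum>A\<in>F. if A \<in> Z then 1 else 0) = card Z"
    using fin(1) Z(1) by (simp add: sum.If_cases Int_absorb1)
  ultimately show ?thesis
    by (simp add: total_size_def edges_def sum.distrib sum_Suc)
qed

lemma simply_rooted_obtains:
  assumes "simply_rooted \<B>" "B \<in> \<B>" "B \<noteq> {}"
  obtains b where "b \<in> B" "rooted_at \<B> B b"
proof -
  have "\<exists>b\<in>B. {{b}..B} \<subseteq> \<B>"
    using assms by (simp add: simply_rooted_def)
  then obtain b where "b \<in> B" "{{b}..B} \<subseteq> \<B>" by (rule bexE)
  then show thesis by (intro that[of b]) (simp_all add: rooted_at_def)
qed

lemma rooted_at_Diff: "rooted_at \<B> A b \<Longrightarrow> i \<noteq> b \<Longrightarrow> A - {i} \<in> \<B> \<and> rooted_at \<B> (A - {i}) b"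
  by (auto simp: rooted_at_def subset_iff)

text \<open>Deleting an element other than the root shrinks the interval above the root, so the root
  survives.\<close>

lemma rooted_subfamily_Diff:
  assumes "A \<in> rooted_subfamily \<B> S"
  shows "\<exists>b\<in>A. \<forall>i\<in>A - {b}. A - {i} \<in> rooted_subfamily \<B> S"
proof -
  obtain b where b: "b \<in> S" "rooted_at \<B> A b"
    using assms by (auto simp: rooted_subfamily_def)
  then have "\<forall>i\<in>A - {b}. A - {i} \<in> rooted_subfamily \<B> S"
    using rooted_at_Diff[of \<B> A b] by (auto simp: rooted_subfamily_def)
  then show ?thesis using b by (auto simp: rooted_at_def)
qed

lemma simply_rooted_total_size_le:
  assumes V: "finite V" "\<B> \<subseteq> Pow V" and rooted: "simply_rooted \<B>"
  shows "3 * real (total_size \<B>) \<le> 3 * real (bitsum (card \<B>)) + 3 * real (card \<B>)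
    - real (card (rooted_subfamily \<B> S)) * real (card (\<B> - rooted_subfamily \<B> S)) / 2 ^ card V"
proof -
  \<comment> \<open>The empty set has no root, so it is added to \<open>G\<close> by hand to make
    \<open>F \<union> G\<close> all of \<open>\<B>\<close>.\<close>
  define F G where "F = rooted_subfamily \<B> S" and "G = rooted_subfamily \<B> (- S) \<union> (\<B> \<inter> {{}})"
  have finB: "finite \<B>" using V by (auto intro: finite_subset[of _ "Pow V"])
  have finA: "finite A" if "A \<in> \<B>" for A using that V by (auto intro: finite_subset[of _ V])
  have "F \<subseteq> \<B>" "G \<subseteq> \<B>" by (auto simp: F_def G_def rooted_subfamily_def)
  have FG: "F \<union> G = \<B>"
  proof
    show "\<B> \<subseteq> F \<union> G"
    proof
      fix A assume A: "A \<in> \<B>"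
      show "A \<in> F \<union> G"
      proof (cases "A = {}")
        case False
        then obtain b where "rooted_at \<B> A b"
          using simply_rooted_obtains[OF rooted A] by metis
        then show ?thesis
          using A by (auto simp: F_def G_def rooted_subfamily_def)
      qed (use A in \<open>auto simp: G_def\<close>)
    qed
  qed (use \<open>F \<subseteq> \<B>\<close> \<open>G \<subseteq> \<B>\<close> in auto)
  have fin: "finite F" "finite G" using \<open>F \<subseteq> \<B>\<close> \<open>G \<subseteq> \<B>\<close> finB finite_subset by auto
  have Z: "A - {i} \<in> \<B>" if A: "A \<in> F \<inter> G" and "i \<in> A" for A i
  proof -
    obtain b where b: "b \<in> S" "rooted_at \<B> A b"
      using A by (auto simp: F_def rooted_subfamily_def)
    \<comment> \<open>As A contains b, it is not the empty set added to \<open>G\<close>. Two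
      distinct roots leave no missing down-neighbour, since i differs from one of them.\<close>
    moreover obtain c where "c \<notin> S" "rooted_at \<B> A c"
      using A b by (auto simp: G_def rooted_subfamily_def rooted_at_def)
    ultimately show ?thesis using rooted_at_Diff[of \<B> A] by metis
  qed
  have "\<exists>b\<in>A. \<forall>i\<in>A - {b}. A - {i} \<in> F" if "A \<in> F" for A
    using rooted_subfamily_Diff that by (auto simp: F_def)
  then have F: "total_size F \<le> edges F + card F"
    using total_size_le_edges[of F "{}"] fin finA \<open>F \<subseteq> \<B>\<close> by auto
  have rootG: "\<exists>b\<in>A. \<forall>i\<in>A - {b}. A - {i} \<in> G" if "A \<in> G" "A \<noteq> {}" for A
    using rooted_subfamily_Diff[of A \<B> "- S"] that by (auto simp: G_def)
  then have G: "total_size G \<le> edges G + card G"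
    using total_size_le_edges[of G "{}"] fin finA \<open>G \<subseteq> \<B>\<close> by auto
  have rootB: "\<exists>b\<in>A. \<forall>i\<in>A - {b}. A - {i} \<in> \<B>" if "A \<in> \<B>" "A \<noteq> {}" for A
  proof -
    obtain b where "rooted_at \<B> A b"
      using simply_rooted_obtains[OF rooted \<open>A \<in> \<B>\<close> \<open>A \<noteq> {}\<close>] by metis
    then show ?thesis
      using rooted_at_Diff[of \<B> A b] by (intro bexI[of _ b]) (auto simp: rooted_at_def)
  qed
  have 1: "total_size \<B> + card (F \<inter> G) \<le> bitsum (card \<B>) + card \<B>"
    using total_size_le_edges[OF finB finA rootB, of "F \<inter> G"] Z edges_le[OF V] FG by fastforce
  have "total_size F + total_size G = total_size \<B> + total_size (F \<inter> G)"
    unfolding total_size_def FG[symmetric] using fin by (simp add: sum.union_inter)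
  moreover have "card F + card G = card \<B> + card (F \<inter> G)"
    using card_Un_Int[OF fin] FG by simp
  moreover have "real (edges F) + real (edges G) - real (total_size (F \<inter> G))
      \<le> real (bitsum (card \<B>)) - real (card F) * real (card G) / 2 ^ card V + real (card (F \<inter> G))"
    using edges_pair_le_product[OF V(1), of F G] V(2) FG \<open>F \<subseteq> \<B>\<close> \<open>G \<subseteq> \<B>\<close> by auto
  ultimately have 2: "real (total_size \<B>) \<le> real (bitsum (card \<B>)) + real (card \<B>)
      + 2 * real (card (F \<inter> G)) - real (card F) * real (card G) / 2 ^ card V"
    using F G by linarith
  have "card (\<B> - F) \<le> card G"
    using FG fin by (intro card_mono) auto
  then have "real (card F) * real (card (\<B> - F)) / 2 ^ card V \<le> real (card F) * real (card G) / 2 ^ card V"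
    by (intro divide_right_mono mult_left_mono) auto
  \<comment> \<open>Twice the bound \<open>1\<close> plus the bound \<open>2\<close> cancels
    \<open>card (F \<inter> G)\<close>; this is the source of the factor 3.\<close>
  with 1 2 show ?thesis unfolding F_def[symmetric] by linarith
qed

section \<open>Choosing a balanced initial segment\<close>

text \<open>A discrete intermediate value argument: at the first k with
  \<open>t - d \<le> f k\<close>, the previous value was below \<open>t - d\<close> and one step
  adds at most \<open>d\<close>.\<close>

lemma exists_balanced_value:
  fixes f :: "nat \<Rightarrow> real"
  assumes "f 0 \<le> t" "\<And>k. k < n \<Longrightarrow> f (Suc k) \<le> f k + d" "t - d \<le> f n" "0 \<le> d"
  shows "\<exists>k\<le>n. t - d \<le> f k \<and> f k \<le> t"
proof -
  define P where "P k \<longleftrightarrow> t - d \<le> f k" for k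
  define k where "k = (LEAST k. P k)"
  have "P n" using assms(3) by (simp add: P_def)
  then have k: "P k" "k \<le> n" unfolding k_def by (auto intro: LeastI Least_le)
  have "f k \<le> t"
  proof (cases k)
    case 0
    then show ?thesis using assms(1) by simp
  next
    case (Suc j)
    then have "\<not> P j" using not_less_Least[of j P] by (simp add: k_def)
    then show ?thesis using Suc k(2) assms(2)[of j] by (simp add: P_def)
  qed
  with k show ?thesis by (auto simp: P_def)
qed

theorem theorem8:
  fixes n m :: nat and \<B> :: "nat set set" and p :: real
  assumes "n \<ge> 1"
    and "\<B> \<subseteq> Pow {1..n}"
    and "simply_rooted \<B>"
    and "card \<B> = m"
    and "p \<in> {0..1}"
    and "\<And>i. i \<in> {1..n} \<Longrightarrow> real (card (rooted_subfamily \<B> {i})) \<le> p * real m"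
  shows "real (total_size \<B>) \<le>
    real (total_size (colex_initial m)) + real m
      - (real m)\<^sup>2 * (1 / 12 - p\<^sup>2 / 12) / 2 ^ n"
proof -
  define f where "f k = real (card (rooted_subfamily \<B> {1..k}))" for k
  have p: "0 \<le> p" "p \<le> 1" using assms(5) by auto
  have finB: "finite \<B>" using assms(2) by (rule finite_subset) simp
  have fin: "finite (rooted_subfamily \<B> S)" for S
    using finB by (auto simp: rooted_subfamily_def)
  have rooted: "B \<in> rooted_subfamily \<B> {1..n}" if "B \<in> \<B>" "B \<noteq> {}" for B
  proof -
    obtain b where b: "b \<in> B" "rooted_at \<B> B b"
      using simply_rooted_obtains[OF assms(3) \<open>B \<in> \<B>\<close> \<open>B \<noteq> {}\<close>] .
    moreover have "b \<in> {1..n}" using \<open>b \<in> B\<close> that(1) assms(2) by blast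
    ultimately show ?thesis
      using that(1) by (auto simp: rooted_subfamily_def)
  qed
  \<comment> \<open>The 1 allows for the empty set, the only one that can lack a root.\<close>
  have final: "real m - 1 \<le> f n"
  proof -
    have "card \<B> \<le> card (insert {} (rooted_subfamily \<B> {1..n}))"
      using rooted fin by (intro card_mono) auto
    also have "\<dots> \<le> Suc (card (rooted_subfamily \<B> {1..n}))"
      by (rule card_insert_le_m1) auto
    finally show ?thesis using assms(4) by (simp add: f_def)
  qed
  show ?thesis
  \<comment> \<open>In this family nothing is rooted and f vanishes, so balancing can fail; but its
    total size is 0 and the bound is nonnegative.\<close>
  proof (cases "\<B> = {{}}")
    case True
    then have "m = 1" using assms(4) by simp
    have "1 / 12 - p\<^sup>2 / 12 \<le> 1"
      using zero_le_power2[of p] by linarith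
    then have "(1 / 12 - p\<^sup>2 / 12) / 2 ^ n \<le> (1::real) / 1"
      by (intro frac_le) auto
    moreover have "total_size \<B> = 0"
      using True by (simp add: total_size_def)
    moreover have "(real m)\<^sup>2 = 1" "real m = 1"
      using \<open>m = 1\<close> by simp_all
    ultimately show ?thesis
      by (simp only: mult_1 div_by_1)
  next
    case False
    have "(1 - p) * real m / 2 \<le> f n"
    proof -
      have "f n \<ge> real m / 2"
      proof (cases "m \<ge> 2")
        case True
        then show ?thesis using final by simp
      next
        case m: False
        have "\<B> \<subseteq> rooted_subfamily \<B> {1..n}"
        proof
          fix B assume B: "B \<in> \<B>"
          have "B \<noteq> {}"
          proof
            assume "B = {}"
            with B False obtain C where "C \<in> \<B>" "C \<noteq> B" by auto
            then have "card {B, C} \<le> card \<B>"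
              using B finB by (intro card_mono) auto
            with \<open>C \<noteq> B\<close> m assms(4) show False by simp
          qed
          with B show "B \<in> rooted_subfamily \<B> {1..n}" by (rule rooted)
        qed
        then have "card \<B> \<le> card (rooted_subfamily \<B> {1..n})"
          using fin by (intro card_mono)
        then show ?thesis using assms(4) by (simp add: f_def)
      qed
      moreover have "(1 - p) * real m \<le> 1 * real m" using p by (intro mult_right_mono) auto
      ultimately show ?thesis by simp
    qed
    moreover have "f (Suc k) \<le> f k + p * real m" if "k < n" for k
    proof -
      have "rooted_subfamily \<B> {1..Suc k} = rooted_subfamily \<B> {1..k} \<union> rooted_subfamily \<B> {Suc k}"
      proof -
        have "{1..Suc k} = insert (Suc k) {1..k}" by auto
        then show ?thesis by (simp only: rooted_subfamily_def) blast
      qed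
      then have "card (rooted_subfamily \<B> {1..Suc k})
          \<le> card (rooted_subfamily \<B> {1..k}) + card (rooted_subfamily \<B> {Suc k})"
        using card_Un_le by metis
      then show ?thesis using assms(6)[of "Suc k"] that by (simp add: f_def)
    qed
    moreover have "f 0 = 0" by (simp add: f_def rooted_subfamily_def)
    \<comment> \<open>The window has width \<open>p * real m\<close> and is centred at m /
      2.\<close>
    ultimately obtain k where k: "(1 - p) * real m / 2 \<le> f k" "f k \<le> (1 + p) * real m / 2"
      using exists_balanced_value[of f "(1 + p) * real m / 2" n "p * real m"] p
      by (auto simp: field_simps)
    let ?S = "{1..k}"
    have "rooted_subfamily \<B> ?S \<subseteq> \<B>" by (auto simp: rooted_subfamily_def)
    then have rest: "real (card (\<B> - rooted_subfamily \<B> ?S)) = real m - f k"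
      using fin[of ?S] card_mono[OF finB, of "rooted_subfamily \<B> ?S"] assms(4)
      by (simp add: card_Diff_subset f_def of_nat_diff)
    \<comment> \<open>The product of the distances to the ends of the window is nonnegative;
      expanded, it bounds \<open>f k * (real m - f k)\<close> from below. The resulting 1/4 and the
      factor 3 make up the 1/12.\<close>
    have "0 \<le> (f k - (1 - p) * real m / 2) * ((1 + p) * real m / 2 - f k)"
      using k by (intro mult_nonneg_nonneg) auto
    also have "\<dots> = f k * (real m - f k) - (real m)\<^sup>2 * (1 - p\<^sup>2) / 4"
      by (simp add: field_simps power2_eq_square)
    finally have "(real m)\<^sup>2 * (1 - p\<^sup>2) / 4 \<le> f k * (real m - f k)" by simp
    then have "(real m)\<^sup>2 * (1 - p\<^sup>2) / 4 / 2 ^ n \<le> f k * (real m - f k) / 2 ^ n"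
      by (intro divide_right_mono) auto
    moreover have "3 * real (total_size \<B>) \<le> 3 * real (bitsum m) + 3 * real m - f k * (real m - f k) / 2 ^ n"
      using simply_rooted_total_size_le[OF _ assms(2,3), of ?S] rest assms(4) by (simp add: f_def)
    moreover have "(real m)\<^sup>2 * (1 / 12 - p\<^sup>2 / 12) / 2 ^ n = (real m)\<^sup>2 * (1 - p\<^sup>2) / 4 / 2 ^ n / 3"
      by (simp add: algebra_simps diff_divide_distrib)
    moreover have "t \<le> h + l - c" if "A \<le> B" "3 * t \<le> 3 * h + 3 * l - B" "c = A / 3"
      for t h l c A B :: real
      using that by linarith
    ultimately show ?thesis
      unfolding total_size_colex_initial by blast
  qed
qed

end
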